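(* Let $(A,\cdot)$ be an anti-pre-Lie algebra and let $(V,\rho,\mu)$ be a representation of $(A,\cdot)$. Let $Z^2(A;V)$ be the space of 2-cocycles and $B^2(A;V)$ the space of 2-coboundaries of $(A,\cdot)$ with coefficients in $(V,\rho,\mu)$. Then $B^2(A;V)\subset Z^2(A;V)$.
   Context: All vector spaces are over a field $\mathbb K$. An anti-pre-Lie algebra is a vector space $A$ with a bilinear product $\cdot$ such that for all $x,y,z\in A$, with $[x,y]=x\cdot y-y\cdot x$: (1) $x\cdot(y\cdot z)-y\cdot(x\cdot z)=[y,x]\cdot z$; (2) $[x,y]\cdot z+[y,z]\cdot x+[z,x]\cdot y=0$. A representation of $(A,\cdot)$ on a vector space $V$, written $(V,\rho,\mu)$, is a pair of linear maps $\rho,\mu:A\to\mathfrak{gl}(V)$ such that for all $x,y\in A$: $\rho(x)\rho(y)-\rho(y)\rho(x)=\rho([y,x])$; $\mu(x\cdot y)-\rho(x)\mu(y)=\mu(y)\rho(x)-\mu(y)\mu(x)$; $\mu(y)\mu(x)-\mu(x)\mu(y)+\rho([x,y])=\mu(y)\rho(x)-\mu(x)\rho(y)$. Cochains: $C^n(A;V)=\mathrm{Hom}(A^{\otimes n},V)$. For $f\in C^1(A;V)$, $\mathrm d^1 f(x,y)=\rho(x)f(y)+\mu(y)f(x)-f(x\cdot y)$. For $f\in C^2(A;V)$, $\mathrm d^2_1 f(x,y,z)=\rho(x)f(y,z)-\rho(y)f(x,z)-\mu(z)f(y,x)+\mu(z)f(x,y)-f(y,x\cdot z)+f(x,y\cdot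 z)+f([x,y],z)$, $\mathrm d^2_2 f(x,y,z)=\mu(x)(f(y,z)-f(z,y))+\mu(y)(f(z,x)-f(x,z))+\mu(z)(f(x,y)-f(y,x))+f([x,y],z)+f([y,z],x)+f([z,x],y)$. A 2-cocycle is $f\in C^2(A;V)$ with $\mathrm d^2_1f=0$ and $\mathrm d^2_2f=0$; $Z^2(A;V)$ is the space of 2-cocycles, and $B^2(A;V)=\{\mathrm d^1 f: f\in C^1(A;V)\}$. *)

theory Defs
  imports Complex_Main
begin

definition bilinear_map ::
  "('k::field \<Rightarrow> 'a::ab_group_add \<Rightarrow> 'a) \<Rightarrow> ('k \<Rightarrow> 'b::ab_group_add \<Rightarrow> 'b) \<Rightarrow>
   ('k \<Rightarrow> 'c::ab_group_add \<Rightarrow> 'c) \<Rightarrow> ('a \<Rightarrow> 'b \<Rightarrow> 'c) \<Rightarrow> bool"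
  where "bilinear_map sA sB sC f \<longleftrightarrow>
    (\<forall>x. Vector_Spaces.linear sB sC (\<lambda>y. f x y)) \<and>
    (\<forall>y. Vector_Spaces.linear sA sC (\<lambda>x. f x y))"

definition commutator :: "('a::ab_group_add \<Rightarrow> 'a \<Rightarrow> 'a) \<Rightarrow> 'a \<Rightarrow> 'a \<Rightarrow> 'a"
  where "commutator m x y = m x y - m y x"

locale anti_pre_Lie_algebra = vector_space sA
  for sA :: "'k::field \<Rightarrow> 'a::ab_group_add \<Rightarrow> 'a" +
  fixes m :: "'a \<Rightarrow> 'a \<Rightarrow> 'a"
  assumes bilinear: "bilinear_map sA sA sA m"
    and anti_left_symmetric:
      "\<And>x y z. m x (m y z) - m y (m x z) = m (commutator m y x) z"
    and commutator_cyclic: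
      "\<And>x y z. m (commutator m x y) z + m (commutator m y z) x + m (commutator m z x) y = 0"

text \<open>
  A linear map from \<open>A\<close> to \<open>gl(V)\<close>, where \<open>gl(V)\<close> consists of all linear endomorphisms of \<open>V\<close>
  with the pointwise vector space structure, is the same thing as a curried bilinear map
  \<open>A \<Rightarrow> V \<Rightarrow> V\<close>. The operator identities are stated pointwise on \<open>V\<close>.
\<close>

locale anti_pre_Lie_representation =
  anti_pre_Lie_algebra sA m + V: vector_space sV
  for sA :: "'k::field \<Rightarrow> 'a::ab_group_add \<Rightarrow> 'a"
    and m :: "'a \<Rightarrow> 'a \<Rightarrow> 'a"
    and sV :: "'k \<Rightarrow> 'v::ab_group_add \<Rightarrow> 'v" +
  fixes \<rho> \<mu> :: "'a \<Rightarrow> 'v \<Rightarrow> 'v"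
  assumes rho_linear: "bilinear_map sA sV sV \<rho>"
    and mu_linear: "bilinear_map sA sV sV \<mu>"
    and rho_rho:
      "\<And>x y v. \<rho> x (\<rho> y v) - \<rho> y (\<rho> x v) = \<rho> (commutator m y x) v"
    and mu_mult:
      "\<And>x y v. \<mu> (m x y) v - \<rho> x (\<mu> y v) = \<mu> y (\<rho> x v) - \<mu> y (\<mu> x v)"
    and mu_mu:
      "\<And>x y v. \<mu> y (\<mu> x v) - \<mu> x (\<mu> y v) + \<rho> (commutator m x y) v
               = \<mu> y (\<rho> x v) - \<mu> x (\<rho> y v)"

text \<open>
  Cochains in \<open>Hom(A \<otimes> A, V)\<close> are identified with curried bilinear maps \<open>A \<Rightarrow> A \<Rightarrow> V\<close>.
\<close>

definition cochains1 ::
  "('k::field \<Rightarrow> 'a::ab_group_add \<Rightarrow> 'a) \<Rightarrow> ('k \<Rightarrow> 'v::ab_group_add \<Rightarrow> 'v) \<Rightarrow> ('a \<Rightarrow> 'v) set"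
  where "cochains1 sA sV = {f. Vector_Spaces.linear sA sV f}"

definition cochains2 ::
  "('k::field \<Rightarrow> 'a::ab_group_add \<Rightarrow> 'a) \<Rightarrow> ('k \<Rightarrow> 'v::ab_group_add \<Rightarrow> 'v) \<Rightarrow>
   ('a \<Rightarrow> 'a \<Rightarrow> 'v) set"
  where "cochains2 sA sV = {f. bilinear_map sA sA sV f}"

definition d1 ::
  "('a::ab_group_add \<Rightarrow> 'a \<Rightarrow> 'a) \<Rightarrow> ('a \<Rightarrow> 'v::ab_group_add \<Rightarrow> 'v) \<Rightarrow> ('a \<Rightarrow> 'v \<Rightarrow> 'v) \<Rightarrow>
   ('a \<Rightarrow> 'v) \<Rightarrow> 'a \<Rightarrow> 'a \<Rightarrow> 'v"
  where "d1 m \<rho> \<mu> f x y = \<rho> x (f y) + \<mu> y (f x) - f (m x y)"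

definition d2_1 ::
  "('a::ab_group_add \<Rightarrow> 'a \<Rightarrow> 'a) \<Rightarrow> ('a \<Rightarrow> 'v::ab_group_add \<Rightarrow> 'v) \<Rightarrow> ('a \<Rightarrow> 'v \<Rightarrow> 'v) \<Rightarrow>
   ('a \<Rightarrow> 'a \<Rightarrow> 'v) \<Rightarrow> 'a \<Rightarrow> 'a \<Rightarrow> 'a \<Rightarrow> 'v"
  where "d2_1 m \<rho> \<mu> f x y z =
    \<rho> x (f y z) - \<rho> y (f x z) - \<mu> z (f y x) + \<mu> z (f x y)
    - f y (m x z) + f x (m y z) + f (commutator m x y) z"

definition d2_2 ::
  "('a::ab_group_add \<Rightarrow> 'a \<Rightarrow> 'a) \<Rightarrow> ('a \<Rightarrow> 'v::ab_group_add \<Rightarrow> 'v) \<Rightarrow>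
   ('a \<Rightarrow> 'a \<Rightarrow> 'v) \<Rightarrow> 'a \<Rightarrow> 'a \<Rightarrow> 'a \<Rightarrow> 'v"
  where "d2_2 m \<mu> f x y z =
    \<mu> x (f y z - f z y) + \<mu> y (f z x - f x z) + \<mu> z (f x y - f y x)
    + f (commutator m x y) z + f (commutator m y z) x + f (commutator m z x) y"

definition cocycles2 ::
  "('k::field \<Rightarrow> 'a::ab_group_add \<Rightarrow> 'a) \<Rightarrow> ('a \<Rightarrow> 'a \<Rightarrow> 'a) \<Rightarrow>
   ('k \<Rightarrow> 'v::ab_group_add \<Rightarrow> 'v) \<Rightarrow> ('a \<Rightarrow> 'v \<Rightarrow> 'v) \<Rightarrow> ('a \<Rightarrow> 'v \<Rightarrow> 'v) \<Rightarrow>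
   ('a \<Rightarrow> 'a \<Rightarrow> 'v) set"
  where "cocycles2 sA m sV \<rho> \<mu> =
    {f \<in> cochains2 sA sV. (\<forall>x y z. d2_1 m \<rho> \<mu> f x y z = 0) \<and> (\<forall>x y z. d2_2 m \<mu> f x y z = 0)}"

definition coboundaries2 ::
  "('k::field \<Rightarrow> 'a::ab_group_add \<Rightarrow> 'a) \<Rightarrow> ('a \<Rightarrow> 'a \<Rightarrow> 'a) \<Rightarrow>
   ('k \<Rightarrow> 'v::ab_group_add \<Rightarrow> 'v) \<Rightarrow> ('a \<Rightarrow> 'v \<Rightarrow> 'v) \<Rightarrow> ('a \<Rightarrow> 'v \<Rightarrow> 'v) \<Rightarrow>
   ('a \<Rightarrow> 'a \<Rightarrow> 'v) set"
  where "coboundaries2 sA m sV \<rho> \<mu> = d1 m \<rho> \<mu> ` cochains1 sA sV"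

end

theory Submission imports Defs begin

text \<open>
  Collecting the terms of \<open>d2_1 (d1 f) x y z\<close> and \<open>d2_2 (d1 f) x y z\<close> according to the argument of
  \<open>f\<close>, the coefficient of \<open>f x\<close>, \<open>f y\<close> or \<open>f z\<close> vanishes by a representation axiom, while the terms
  where \<open>f\<close> takes a triple product as argument add up to \<open>f\<close> applied to an axiom of the algebra.
\<close>

lemma bilinear_map_add_left:
  "bilinear_map sA sB sC b \<Longrightarrow> b (x + x') y = b x y + b x' y"
  by (auto simp: bilinear_map_def Vector_Spaces.linear_iff)

lemma bilinear_map_add_right:
  "bilinear_map sA sB sC b \<Longrightarrow> b x (y + y') = b x y + b x y'"
  by (auto simp: bilinear_map_def Vector_Spaces.linear_iff)

lemma bilinear_map_diff_left:
  "bilinear_map sA sB sC b \<Longrightarrow> b (x - x') y = b x y - b x' y"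
  using bilinear_map_add_left[of sA sB sC b "x - x'" x' y] by (simp add: eq_diff_eq)

lemma bilinear_map_diff_right:
  "bilinear_map sA sB sC b \<Longrightarrow> b x (y - y') = b x y - b x y'"
  using bilinear_map_add_right[of sA sB sC b x "y - y'" y'] by (simp add: eq_diff_eq)

context anti_pre_Lie_representation
begin

text \<open>As rewrite rules these expand the differentials of \<open>d1 m \<rho> \<mu> f\<close>
  into signed monomials. Difference rules suffice for \<open>m\<close>: there its arguments become
  compound only through \<open>commutator\<close>.\<close>

lemmas bilinear_distribs =
  bilinear_map_add_left[OF rho_linear] bilinear_map_add_right[OF rho_linear]
  bilinear_map_diff_left[OF rho_linear] bilinear_map_diff_right[OF rho_linear]
  bilinear_map_add_left[OF mu_linear] bilinear_map_add_right[OF mu_linear]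
  bilinear_map_diff_left[OF mu_linear] bilinear_map_diff_right[OF mu_linear]
  bilinear_map_diff_left[OF bilinear] bilinear_map_diff_right[OF bilinear]

text \<open>Membership in \<open>cocycles2\<close> includes being a 2-cochain. Each summand of
  \<open>d1\<close> composes a bilinear map with the linear \<open>f\<close>, hence is additive and
  homogeneous in each argument.\<close>

lemma d1_bilinear:
  assumes "Vector_Spaces.linear sA sV f"
  shows "bilinear_map sA sA sV (d1 m \<rho> \<mu> f)"
  using assms bilinear rho_linear mu_linear
  unfolding bilinear_map_def Vector_Spaces.linear_iff d1_def
  by (simp add: algebra_simps V.scale_right_distrib V.scale_right_diff_distrib)

lemma d2_1_d1_eq_0:
  assumes "Vector_Spaces.linear sA sV f"
  shows "d2_1 m \<rho> \<mu> (d1 m \<rho> \<mu> f) x y z = 0"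
proof -
  interpret f: Vector_Spaces.linear sA sV f by fact
  have alg: "f (m x (m y z)) - f (m y (m x z)) = f (m (m y x) z) - f (m (m x y) z)"
    using arg_cong[OF anti_left_symmetric[of x y z], of f]
    by (simp add: commutator_def bilinear_distribs f.diff)
  have fz: "\<rho> x (\<rho> y (f z)) - \<rho> y (\<rho> x (f z)) + \<rho> (m x y) (f z) - \<rho> (m y x) (f z) = 0"
    using rho_rho[of x y "f z"] by (simp add: commutator_def bilinear_distribs)
  have fy: "\<rho> x (\<mu> z (f y)) - \<mu> z (\<mu> x (f y)) + \<mu> z (\<rho> x (f y)) - \<mu> (m x z) (f y) = 0"
    using mu_mult[of x z "f y"] by (simp add: algebra_simps)
  \<comment> \<open>This is \<open>fy\<close> with \<open>x\<close> and \<open>y\<close> exchanged;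
    it enters the sum below with a minus sign because \<open>d2_1\<close> is skew in its first two
    arguments.\<close>
  have fx: "\<rho> y (\<mu> z (f x)) - \<mu> z (\<mu> y (f x)) + \<mu> z (\<rho> y (f x)) - \<mu> (m y z) (f x) = 0"
    using mu_mult[of y z "f x"] by (simp add: algebra_simps)
  \<comment> \<open>Terms with \<rho> or \<mu> acting on \<open>f\<close> of a product have
    cancelled: for instance \<open>\<rho> x (f (m y z))\<close> comes with a minus from
    \<open>\<rho> x (d1 m \<rho> \<mu> f y z)\<close> and a plus from
    \<open>d1 m \<rho> \<mu> f x (m y z)\<close>. The remaining brackets copy the left sides of
    \<open>fz\<close>, \<open>fy\<close>, \<open>fx\<close> and \<open>alg\<close> literally, so
    that unfolding can replace them.\<close>
  have "d2_1 m \<rho> \<mu> (d1 m \<rho> \<mu> f) x y z =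
      (\<rho> x (\<rho> y (f z)) - \<rho> y (\<rho> x (f z)) + \<rho> (m x y) (f z) - \<rho> (m y x) (f z))
    + (\<rho> x (\<mu> z (f y)) - \<mu> z (\<mu> x (f y)) + \<mu> z (\<rho> x (f y)) - \<mu> (m x z) (f y))
    - (\<rho> y (\<mu> z (f x)) - \<mu> z (\<mu> y (f x)) + \<mu> z (\<rho> y (f x)) - \<mu> (m y z) (f x))
    - (f (m x (m y z)) - f (m y (m x z)) - (f (m (m y x) z) - f (m (m x y) z)))"
    unfolding d2_1_def d1_def commutator_def
    by (simp only: bilinear_distribs f.diff) (simp add: algebra_simps)
  then show ?thesis
    unfolding fz fy fx alg by simp
qed

lemma d2_2_d1_eq_0:
  assumes "Vector_Spaces.linear sA sV f"
  shows "d2_2 m \<mu> (d1 m \<rho> \<mu> f) x y z = 0"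
proof -
  interpret f: Vector_Spaces.linear sA sV f by fact
  have alg: "f (m (m x y) z) - f (m (m y x) z) + (f (m (m y z) x) - f (m (m z y) x))
      + (f (m (m z x) y) - f (m (m x z) y)) = 0"
    using arg_cong[OF commutator_cyclic[of x y z], of f]
    by (simp add: commutator_def bilinear_distribs f.diff f.add)
  \<comment> \<open>Since \<open>d2_2\<close> is cyclic in its arguments, one identity serves three
    times, with \<open>(a, b, v)\<close> equal to \<open>(x, y, f z)\<close>,
    \<open>(y, z, f x)\<close> and \<open>(z, x, f y)\<close>.\<close>
  have rep: "\<mu> b (\<mu> a v) - \<mu> a (\<mu> b v) + (\<rho> (m a b) v - \<rho> (m b a) v)
      - (\<mu> b (\<rho> a v) - \<mu> a (\<rho> b v)) = 0" for a b v
    using mu_mu[of b a v] by (simp add: commutator_def bilinear_distribs)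
  \<comment> \<open>Here \<open>\<mu> x (f (m y z) - f (m z y))\<close> arises twice with opposite
    signs, the second time from \<open>d1\<close> at the commutator of \<open>y\<close> and
    \<open>z\<close>, paired with \<open>x\<close>; its cyclic shifts cancel likewise.\<close>
  have "d2_2 m \<mu> (d1 m \<rho> \<mu> f) x y z =
      (\<mu> y (\<mu> x (f z)) - \<mu> x (\<mu> y (f z)) + (\<rho> (m x y) (f z) - \<rho> (m y x) (f z))
        - (\<mu> y (\<rho> x (f z)) - \<mu> x (\<rho> y (f z))))
    + (\<mu> z (\<mu> y (f x)) - \<mu> y (\<mu> z (f x)) + (\<rho> (m y z) (f x) - \<rho> (m z y) (f x))
        - (\<mu> z (\<rho> y (f x)) - \<mu> y (\<rho> z (f x))))
    + (\<mu> x (\<mu> z (f y)) - \<mu> z (\<mu> x (f y)) + (\<rho> (m z x) (f y) - \<rho> (m x z) (f y))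
        - (\<mu> x (\<rho> z (f y)) - \<mu> z (\<rho> x (f y))))
    - (f (m (m x y) z) - f (m (m y x) z) + (f (m (m y z) x) - f (m (m z y) x))
      + (f (m (m z x) y) - f (m (m x z) y)))"
    unfolding d2_2_def d1_def commutator_def
    by (simp only: bilinear_distribs f.diff) (simp add: algebra_simps)
  then show ?thesis
    unfolding rep alg by simp
qed

end

theorem proposition2p10:
  fixes sA :: "'k::field \<Rightarrow> 'a::ab_group_add \<Rightarrow> 'a"
    and m :: "'a \<Rightarrow> 'a \<Rightarrow> 'a"
    and sV :: "'k \<Rightarrow> 'v::ab_group_add \<Rightarrow> 'v"
    and \<rho> \<mu> :: "'a \<Rightarrow> 'v \<Rightarrow> 'v"
  assumes "anti_pre_Lie_algebra sA m"
    and "anti_pre_Lie_representation sA m sV \<rho> \<mu>"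
  shows "coboundaries2 sA m sV \<rho> \<mu> \<subseteq> cocycles2 sA m sV \<rho> \<mu>"
proof -
  interpret anti_pre_Lie_representation sA m sV \<rho> \<mu> by fact
  show ?thesis
    by (auto simp: coboundaries2_def cocycles2_def cochains1_def cochains2_def
        d1_bilinear d2_1_d1_eq_0 d2_2_d1_eq_0)
qed

end
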